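(* Let $X$ and $Y$ be binary random variables (with values in $\{0,1\}$ and arbitrary joint distribution) and let $Z=X\oplus Y$. Define $$\Delta_1=\min_{U:\,U - X - (Y,Z)}\big[H(Z|U)-H(Y|U)\big],\qquad \Delta_2=\min_{V:\,V - Y - (X,Z)}\big[H(Z|V)-H(X|V)\big],\qquad \bar\Delta=\max\{\Delta_1,\Delta_2\},$$ where $A-B-C$ means that $A$ and $C$ are conditionally independent given $B$. Then for every $n$, every non-interactive code of blocklength $n$ with public messages $F_1,F_2$ and keys $K_A,K_B$ satisfies $$\frac1nH(Z^n|F_1,F_2)\ge\frac{\bar\Delta}{2}+\frac{I(K_A;K_B|F_1,F_2)}{2n}.$$
   Context: All random variables have finite alphabets. $H$ and $I$ denote Shannon entropy and mutual information. The minima are over finite-alphabet auxiliary random variables. Non-interactive code of blocklength $n$: $(X^n,Y^n,Z^n)$ are $n$ i.i.d. copies of $(X,Y,Z)$. Alice (observing $X^n$) generates $F_1$ according to some $P_{F_1|X^n}$ and Bob (observing $Y^n$) generates $F_2$ according to some $P_{F_2|Y^n}$, using independent local randomness. Both messages are exchanged publicly; then Alice generates a key $K_A$ according to some $P_{K_A|X^n,F_1,F_2}$ and Bob generates a key $K_B$ according to some $P_{K_B|Y^n,F_1,F_2}$, again with independent local randomness. Thus the joint law of $(X^n,Y^n,F_1,F_2,K_A,K_B)$ is $P_{X^n,Y^n}P_{F_1|X^n}P_{F_2|Y^n}P_{K_A|X^n,F_1,F_2}P_{K_B|Y^n,F_1,F_2}$, with $Z^n=X^n\oplus Y^n$ componentwise.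 *)

theory Defs
  imports "HOL-Probability.Probability"
begin

text \<open>
  A tuple of jointly distributed random variables is given by its joint law \<open>p\<close>, and a random
  variable is a function on the sample space of \<open>p\<close>. The information measures below are the
  library's general ones, in bits. They take their meaning from the counting measure being
  sigma-finite, so they are to be used for variables with values in a countable type
  (see \<open>pmf_cond_entropy_eq\<close>).
\<close>

definition pmf_cond_entropy :: "'w pmf \<Rightarrow> ('w \<Rightarrow> 'a) \<Rightarrow> ('w \<Rightarrow> 'b) \<Rightarrow> real" where
  "pmf_cond_entropy p A B =
     prob_space.conditional_entropy (measure_pmf p) 2 (count_space UNIV) (count_space UNIV) A B"

definition pmf_cond_mutual_information ::
    "'w pmf \<Rightarrow> ('w \<Rightarrow> 'a) \<Rightarrow> ('w \<Rightarrow> 'b) \<Rightarrow> ('w \<Rightarrow> 'c) \<Rightarrow> real" where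
  "pmf_cond_mutual_information p A B C =
     prob_space.conditional_mutual_information (measure_pmf p) 2
       (count_space UNIV) (count_space UNIV) (count_space UNIV) A B C"

text \<open>
  \<open>A - B - C\<close>: \<open>A\<close> and \<open>C\<close> are conditionally independent given \<open>B\<close>. Where \<open>B = b\<close> has
  probability zero the equation reads \<open>0 = 0 * 0\<close>.
\<close>

definition markov_chain :: "'w pmf \<Rightarrow> ('w \<Rightarrow> 'a) \<Rightarrow> ('w \<Rightarrow> 'b) \<Rightarrow> ('w \<Rightarrow> 'c) \<Rightarrow> bool" where
  "markov_chain p A B C \<longleftrightarrow>
     (\<forall>a b c. \<P>(w in measure_pmf p. (A w = a \<and> C w = c) \<bar> B w = b) =
        \<P>(w in measure_pmf p. A w = a \<bar> B w = b) * \<P>(w in measure_pmf p. C w = c \<bar> B w = b))"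

text \<open>
  Bits are booleans, so that \<open>\<noteq>\<close> is exclusive or. The auxiliary variable ranges over all finite
  alphabets: up to renaming of symbols, these are the finite supports in \<open>nat\<close>. An auxiliary
  variable jointly distributed with \<open>(X, Y) \<sim> pxy\<close> is a law on \<open>((x, y), u)\<close> with first marginal
  \<open>pxy\<close>.

  The minima are written as infima. The sets are nonempty and bounded below
  (\<open>Delta1_set_nonempty\<close>, \<open>Delta1_set_bdd_below\<close> and their analogues), and the infimum
  of a set of reals is its minimum whenever the minimum exists.
\<close>

definition Delta1_set :: "(bool \<times> bool) pmf \<Rightarrow> real set" where
  "Delta1_set pxy =
     {pmf_cond_entropy q (\<lambda>((x, y), u). x \<noteq> y) (\<lambda>((x, y), u). u)
      - pmf_cond_entropy q (\<lambda>((x, y), u). y) (\<lambda>((x, y), u). u)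
      | q :: ((bool \<times> bool) \<times> nat) pmf.
        finite (set_pmf q) \<and> map_pmf fst q = pxy \<and>
        markov_chain q (\<lambda>((x, y), u). u) (\<lambda>((x, y), u). x) (\<lambda>((x, y), u). (y, x \<noteq> y))}"

definition Delta2_set :: "(bool \<times> bool) pmf \<Rightarrow> real set" where
  "Delta2_set pxy =
     {pmf_cond_entropy q (\<lambda>((x, y), v). x \<noteq> y) (\<lambda>((x, y), v). v)
      - pmf_cond_entropy q (\<lambda>((x, y), v). x) (\<lambda>((x, y), v). v)
      | q :: ((bool \<times> bool) \<times> nat) pmf.
        finite (set_pmf q) \<and> map_pmf fst q = pxy \<and>
        markov_chain q (\<lambda>((x, y), v). v) (\<lambda>((x, y), v). y) (\<lambda>((x, y), v). (x, x \<noteq> y))}"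

definition Delta1 :: "(bool \<times> bool) pmf \<Rightarrow> real" where
  "Delta1 pxy = Inf (Delta1_set pxy)"

definition Delta2 :: "(bool \<times> bool) pmf \<Rightarrow> real" where
  "Delta2 pxy = Inf (Delta2_set pxy)"

definition Delta_bar :: "(bool \<times> bool) pmf \<Rightarrow> real" where
  "Delta_bar pxy = max (Delta1 pxy) (Delta2 pxy)"

text \<open>
  The joint law of \<open>(X\<^sup>n, Y\<^sup>n, F\<^sub>1, F\<^sub>2, K\<^sub>A, K\<^sub>B)\<close> induced by a non-interactive code of
  blocklength \<open>n\<close>, which consists of four stochastic kernels.
\<close>

definition code_law ::
    "nat \<Rightarrow> (bool \<times> bool) pmf \<Rightarrow>
     (bool list \<Rightarrow> 'f1 pmf) \<Rightarrow> (bool list \<Rightarrow> 'f2 pmf) \<Rightarrow>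
     (bool list \<Rightarrow> 'f1 \<Rightarrow> 'f2 \<Rightarrow> 'ka pmf) \<Rightarrow> (bool list \<Rightarrow> 'f1 \<Rightarrow> 'f2 \<Rightarrow> 'kb pmf) \<Rightarrow>
     (bool list \<times> bool list \<times> 'f1 \<times> 'f2 \<times> 'ka \<times> 'kb) pmf" where
  "code_law n pxy PF1 PF2 PKA PKB =
     do {
       xys \<leftarrow> replicate_pmf n pxy;
       let xs = map fst xys;
       let ys = map snd xys;
       f1 \<leftarrow> PF1 xs;
       f2 \<leftarrow> PF2 ys;
       ka \<leftarrow> PKA xs f1 f2;
       kb \<leftarrow> PKB ys f1 f2;
       return_pmf (xs, ys, f1, f2, ka, kb)
     }"

lemma pmf_cond_entropy_eq:
  fixes p :: "'w pmf" and A :: "'w \<Rightarrow> 'a :: countable" and B :: "'w \<Rightarrow> 'b :: countable"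
  assumes fin: "finite (set_pmf p)"
  shows "pmf_cond_entropy p A B =
    - (\<Sum>(a, b) \<in> (\<lambda>w. (A w, B w)) ` set_pmf p. pmf (map_pmf (\<lambda>w. (A w, B w)) p) (a, b) *
         log 2 (pmf (map_pmf (\<lambda>w. (A w, B w)) p) (a, b) / pmf (map_pmf B p) b))"
proof -
  interpret information_space "measure_pmf p" 2
    by unfold_locales simp
  have prodUNIV: "count_space (UNIV :: 'a set) \<Otimes>\<^sub>M count_space (UNIV :: 'b set) = count_space UNIV"
    by (simp add: pair_measure_countable)
  have dist: "distributed (measure_pmf p) (count_space UNIV) C (pmf (map_pmf C p))"
    for C :: "'w \<Rightarrow> 'c :: countable"
    unfolding distributed_def
    by (simp add: map_pmf_rep_eq[symmetric] measure_pmf_eq_density[symmetric])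
  have sf: "sigma_finite_measure (count_space (UNIV :: 'c :: countable set))"
    by (simp add: sigma_finite_measure_count_space_countable)
  let ?P = "map_pmf (\<lambda>w. (A w, B w)) p"
  have "pmf_cond_entropy p A B = - (\<integral>(x, y). pmf ?P (x, y) *
      log 2 (pmf ?P (x, y) / pmf (map_pmf B p) y) \<partial>count_space UNIV)"
    unfolding pmf_cond_entropy_def
    by (subst conditional_entropy_generic_eq[OF sf sf dist _, where Pxy = "pmf ?P"])
       (simp_all add: prodUNIV dist)
  also have "(\<integral>(x, y). pmf ?P (x, y) *
      log 2 (pmf ?P (x, y) / pmf (map_pmf B p) y) \<partial>count_space UNIV) =
    (\<Sum>(a, b) \<in> (\<lambda>w. (A w, B w)) ` set_pmf p. pmf ?P (a, b) *
       log 2 (pmf ?P (a, b) / pmf (map_pmf B p) b))"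
  proof (subst lebesgue_integral_count_space_finite_support)
    let ?g = "\<lambda>(x, y). pmf ?P (x, y) * log 2 (pmf ?P (x, y) / pmf (map_pmf B p) y)"
    have sub: "{a \<in> UNIV. ?g a \<noteq> 0} \<subseteq> (\<lambda>w. (A w, B w)) ` set_pmf p"
    proof
      fix ab assume "ab \<in> {a \<in> UNIV. ?g a \<noteq> 0}"
      then have "pmf ?P ab \<noteq> 0" by (cases ab) auto
      then have "ab \<in> set_pmf ?P" by (simp only: set_pmf_iff not_False_eq_True)
      then show "ab \<in> (\<lambda>w. (A w, B w)) ` set_pmf p" by simp
    qed
    show "finite {a \<in> UNIV. ?g a \<noteq> 0}"
      using finite_subset[OF sub] fin by simp
    show "sum ?g {a \<in> UNIV. ?g a \<noteq> 0} = sum ?g ((\<lambda>w. (A w, B w)) ` set_pmf p)"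
      by (rule sum.mono_neutral_left) (use sub fin in auto)
  qed
  finally show ?thesis .
qed

lemma pmf_map_pair_le: "pmf (map_pmf (\<lambda>w. (A w, B w)) p) (a, b) \<le> pmf (map_pmf B p) b"
  unfolding pmf_map by (rule measure_pmf.finite_measure_mono) auto

lemma pmf_cond_entropy_nonneg:
  fixes p :: "'w pmf" and A :: "'w \<Rightarrow> 'a :: countable" and B :: "'w \<Rightarrow> 'b :: countable"
  assumes "finite (set_pmf p)"
  shows "0 \<le> pmf_cond_entropy p A B"
proof -
  let ?P = "map_pmf (\<lambda>w. (A w, B w)) p"
  have "pmf ?P (a, b) * log 2 (pmf ?P (a, b) / pmf (map_pmf B p) b) \<le> 0" for a b
  proof (cases "pmf ?P (a, b) = 0")
    case False
    then have pos: "0 < pmf ?P (a, b)" by (simp add: pmf_nonneg order_less_le)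
    moreover have "0 < pmf (map_pmf B p) b" using pos pmf_map_pair_le[of A B p a b] by linarith
    ultimately have "log 2 (pmf ?P (a, b) / pmf (map_pmf B p) b) \<le> 0"
      using pmf_map_pair_le[of A B p a b] by (subst log_le_zero_cancel_iff) auto
    then show ?thesis by (simp add: mult_nonneg_nonpos)
  qed simp
  then show ?thesis
    unfolding pmf_cond_entropy_eq[OF assms] by (auto intro!: sum_nonpos)
qed

lemma pmf_cond_entropy_le:
  fixes p :: "'w pmf" and A :: "'w \<Rightarrow> bool" and B :: "'w \<Rightarrow> 'b :: countable"
  assumes fin: "finite (set_pmf p)"
  shows "pmf_cond_entropy p A B \<le> 2 / ln 2"
proof -
  let ?P = "map_pmf (\<lambda>w. (A w, B w)) p"
  let ?Q = "map_pmf B p"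
  have bound: "- (pmf ?P (a, b) * log 2 (pmf ?P (a, b) / pmf ?Q b)) \<le> pmf ?Q b / ln 2" for a b
  proof (cases "pmf ?P (a, b) = 0")
    case False
    then have pos: "0 < pmf ?P (a, b)" by (simp add: pmf_nonneg order_less_le)
    then have posQ: "0 < pmf ?Q b" using pmf_map_pair_le[of A B p a b] by linarith
    have "- ln (pmf ?P (a, b) / pmf ?Q b) = ln (pmf ?Q b / pmf ?P (a, b))"
      using pos posQ by (simp add: ln_div)
    also have "\<dots> \<le> pmf ?Q b / pmf ?P (a, b) - 1"
      using pos posQ by (intro ln_le_minus_one) simp
    finally have "pmf ?P (a, b) * - ln (pmf ?P (a, b) / pmf ?Q b)
        \<le> pmf ?P (a, b) * (pmf ?Q b / pmf ?P (a, b))"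
      using pos by (intro mult_left_mono) auto
    then have "- (pmf ?P (a, b) * ln (pmf ?P (a, b) / pmf ?Q b)) \<le> pmf ?Q b"
      using pos by simp
    then have "- (pmf ?P (a, b) * ln (pmf ?P (a, b) / pmf ?Q b)) / ln 2 \<le> pmf ?Q b / ln 2"
      by (intro divide_right_mono) auto
    then show ?thesis by (simp add: log_def)
  qed simp
  have "pmf_cond_entropy p A B = (\<Sum>(a, b) \<in> (\<lambda>w. (A w, B w)) ` set_pmf p.
      - (pmf ?P (a, b) * log 2 (pmf ?P (a, b) / pmf ?Q b)))"
    unfolding pmf_cond_entropy_eq[OF fin] by (simp add: sum_negf case_prod_unfold)
  also have "\<dots> \<le> (\<Sum>(a, b) \<in> (\<lambda>w. (A w, B w)) ` set_pmf p. pmf ?Q b / ln 2)"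
    by (rule sum_mono) (use bound in auto)
  also have "\<dots> \<le> (\<Sum>(a, b) \<in> (UNIV :: bool set) \<times> B ` set_pmf p. pmf ?Q b / ln 2)"
    by (rule sum_mono2) (use fin in auto)
  also have "\<dots> = 2 * (\<Sum>b \<in> B ` set_pmf p. pmf ?Q b) / ln 2"
    by (simp add: sum.cartesian_product[symmetric] sum_divide_distrib[symmetric] UNIV_bool)
  also have "(\<Sum>b \<in> B ` set_pmf p. pmf ?Q b) = 1"
    using fin by (intro sum_pmf_eq_1) auto
  finally show ?thesis by simp
qed

lemma markov_chain_const: "markov_chain p (\<lambda>_. u) B C"
  unfolding markov_chain_def
proof (intro allI)
  fix a b c
  have "measure_pmf.prob p {w. B w = b \<and> C w = c} = 0"
    if "measure_pmf.prob p {w. B w = b} = 0"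
    using that measure_pmf.finite_measure_mono[of "{w. B w = b \<and> C w = c}" "{w. B w = b}" p]
      measure_nonneg[of "measure_pmf p" "{w. B w = b \<and> C w = c}"] by auto
  then show "\<P>(w in measure_pmf p. (u = a \<and> C w = c) \<bar> B w = b) =
      \<P>(w in measure_pmf p. u = a \<bar> B w = b) * \<P>(w in measure_pmf p. C w = c \<bar> B w = b)"
    by (cases "u = a"; cases "measure_pmf.prob p {w. B w = b} = 0")
       (simp_all add: cond_prob_def conj_commute)
qed

lemma markov_chain_map_pmf:
  "markov_chain (map_pmf f p) A B C \<longleftrightarrow>
     markov_chain p (\<lambda>w. A (f w)) (\<lambda>w. B (f w)) (\<lambda>w. C (f w))"
  by (simp add: markov_chain_def cond_prob_def)

lemma finite_set_pmf_bool: "finite (set_pmf (pxy :: (bool \<times> bool) pmf))"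
  by (rule finite_subset[of _ UNIV]) auto

lemma Delta1_set_nonempty: "Delta1_set pxy \<noteq> {}"
proof -
  define q where "q = map_pmf (\<lambda>z. (z, 0 :: nat)) pxy"
  have "finite (set_pmf q)" "map_pmf fst q = pxy"
    using finite_set_pmf_bool[of pxy] by (auto simp: q_def map_pmf_comp)
  moreover have "markov_chain q (\<lambda>((x, y), u). u) (\<lambda>((x, y), u). x) (\<lambda>((x, y), u). (y, x \<noteq> y))"
    unfolding q_def markov_chain_map_pmf by (simp add: case_prod_unfold markov_chain_const)
  ultimately show ?thesis unfolding Delta1_set_def by blast
qed

lemma Delta2_set_nonempty: "Delta2_set pxy \<noteq> {}"
proof -
  define q where "q = map_pmf (\<lambda>z. (z, 0 :: nat)) pxy"
  have "finite (set_pmf q)" "map_pmf fst q = pxy"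
    using finite_set_pmf_bool[of pxy] by (auto simp: q_def map_pmf_comp)
  moreover have "markov_chain q (\<lambda>((x, y), v). v) (\<lambda>((x, y), v). y) (\<lambda>((x, y), v). (x, x \<noteq> y))"
    unfolding q_def markov_chain_map_pmf by (simp add: case_prod_unfold markov_chain_const)
  ultimately show ?thesis unfolding Delta2_set_def by blast
qed

lemma pmf_cond_entropy_diff_ge:
  fixes A A' :: "'w \<Rightarrow> bool" and B :: "'w \<Rightarrow> 'b :: countable"
  assumes "finite (set_pmf q)"
  shows "- (2 / ln 2) \<le> pmf_cond_entropy q A B - pmf_cond_entropy q A' B"
  using pmf_cond_entropy_nonneg[OF assms, of A B] pmf_cond_entropy_le[OF assms, of A' B] by simp

lemma Delta1_set_bdd_below: "bdd_below (Delta1_set pxy)"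
  unfolding Delta1_set_def
  by (rule bdd_belowI[of _ "- (2 / ln 2)"]) (use pmf_cond_entropy_diff_ge in force)

lemma Delta2_set_bdd_below: "bdd_below (Delta2_set pxy)"
  unfolding Delta2_set_def
  by (rule bdd_belowI[of _ "- (2 / ln 2)"]) (use pmf_cond_entropy_diff_ge in force)

end

theory Submission
  imports Defs
begin

text \<open>
  By Csiszar's sum identity, \<open>H(Z\<^sup>n | F\<^sub>1) - H(Y\<^sup>n | F\<^sub>1) \<ge> n \<Delta>\<^sub>1\<close>. As \<open>F\<^sub>2\<close> is a
  function of \<open>Y\<^sup>n\<close> and independent noise, conditioning on it as well reduces the entropy of
  \<open>Y\<^sup>n\<close> at least as much as that of \<open>Z\<^sup>n\<close>, so
  \<open>H(Z\<^sup>n | F\<^sub>1, F\<^sub>2) \<ge> H(Y\<^sup>n | F\<^sub>1, F\<^sub>2) + n \<Delta>\<^sub>1\<close>. By data processing, the right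
  hand side is at least \<open>I(K\<^sub>A; K\<^sub>B | F\<^sub>1, F\<^sub>2) + n \<Delta>\<^sub>1\<close>; adding
  \<open>H(Z\<^sup>n | F\<^sub>1, F\<^sub>2) \<ge> 0\<close> gives the bound with \<open>\<Delta>\<^sub>1\<close>. Exchanging the roles of Alice and
  Bob gives the bound with \<open>\<Delta>\<^sub>2\<close>.
\<close>

section \<open>Entropy as a function of the level sets of a random variable\<close>

text \<open>This is Shannon entropy in bits, written as the expected self-information of the level
  set of \<open>A\<close> that contains the sample point. Phrased on the sample space, it puts no
  type class on the values and lets variables of different types be compared directly.\<close>

definition ent :: "'w pmf \<Rightarrow> ('w \<Rightarrow> 'a) \<Rightarrow> real" where
  "ent p A = measure_pmf.expectation p (\<lambda>w. - log 2 (measure_pmf.prob p {v. A v = A w}))"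

lemma pmf_le_prob_eq: "pmf p w \<le> measure_pmf.prob p {v. A v = A w}"
  unfolding measure_pmf_single[symmetric] by (rule measure_pmf.finite_measure_mono) auto

lemma prob_eq_pos:
  assumes "w \<in> set_pmf p"
  shows "0 < measure_pmf.prob p {v. A v = A w}"
  using pmf_le_prob_eq[of p w A] assms pmf_positive[of w p] by linarith

lemma ent_map: "ent (map_pmf f p) A = ent p (\<lambda>w. A (f w))"
  unfolding ent_def by (simp add: vimage_def)

text \<open>Only the partition of the support into level sets matters, since points off the support
  have mass zero. The rule serves to rename values, permute tuples and drop components determined by
  others.\<close>

lemma ent_cong:
  assumes "\<And>w v. w \<in> set_pmf p \<Longrightarrow> v \<in> set_pmf p \<Longrightarrow> A v = A w \<longleftrightarrow> B v = B w"
  shows "ent p A = ent p B"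
  unfolding ent_def
proof (rule integral_cong_AE)
  show "AE w in measure_pmf p. - log 2 (measure_pmf.prob p {v. A v = A w})
    = - log 2 (measure_pmf.prob p {v. B v = B w})"
  proof (rule AE_pmfI)
    fix w assume w: "w \<in> set_pmf p"
    have "measure_pmf.prob p {v. A v = A w} = measure_pmf.prob p {v. B v = B w}"
      by (rule measure_prob_cong_0) (use assms[OF w] in \<open>auto simp: set_pmf_iff\<close>)
    then show "- log 2 (measure_pmf.prob p {v. A v = A w})
      = - log 2 (measure_pmf.prob p {v. B v = B w})" by simp
  qed
qed simp_all

text \<open>The level sets of \<open>A\<close> refine those of \<open>B\<close>, so the
  self-information grows at every point of the support.\<close>

lemma ent_mono:
  assumes "finite (set_pmf p)" "\<And>w v. A v = A w \<Longrightarrow> B v = B w"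
  shows "ent p B \<le> ent p A"
  unfolding ent_def
proof (rule integral_mono_AE)
  show "AE w in measure_pmf p. - log 2 (measure_pmf.prob p {v. B v = B w})
    \<le> - log 2 (measure_pmf.prob p {v. A v = A w})"
  proof (rule AE_pmfI)
    fix w assume w: "w \<in> set_pmf p"
    have "measure_pmf.prob p {v. A v = A w} \<le> measure_pmf.prob p {v. B v = B w}"
      by (rule measure_pmf.finite_measure_mono) (use assms(2) in blast, simp)
    then have "log 2 (measure_pmf.prob p {v. A v = A w}) \<le> log 2 (measure_pmf.prob p {v. B v = B w})"
      using prob_eq_pos[OF w, of A] prob_eq_pos[OF w, of B] by (subst log_le_cancel_iff) simp_all
    then show "- log 2 (measure_pmf.prob p {v. B v = B w})
      \<le> - log 2 (measure_pmf.prob p {v. A v = A w})" by (rule le_imp_neg_le)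
  qed
qed (rule integrable_measure_pmf_finite[OF assms(1)])+

section \<open>Conditional entropy and mutual information as combinations of joint entropies\<close>

lemma integral_pmf_count_space:
  fixes g :: "'a \<Rightarrow> real"
  shows "(\<integral>x. pmf P x * g x \<partial>count_space UNIV) = measure_pmf.expectation P g"
  unfolding measure_pmf_eq_density[of P] by (subst integral_density) auto

lemma ent_eq_map: "ent p A = measure_pmf.expectation (map_pmf A p) (\<lambda>x. - log 2 (pmf (map_pmf A p) x))"
  unfolding ent_def by (simp add: pmf_map vimage_def)

text \<open>The chain rule: both masses in the quotient are positive on the support, so its
  logarithm splits pointwise under the expectation.\<close>

lemma pmf_cond_entropy_ent:
  fixes p :: "'w pmf" and A :: "'w \<Rightarrow> 'a :: countable" and B :: "'w \<Rightarrow> 'b :: countable"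
  assumes fin: "finite (set_pmf p)"
  shows "pmf_cond_entropy p A B = ent p (\<lambda>w. (A w, B w)) - ent p B"
proof -
  let ?P = "map_pmf (\<lambda>w. (A w, B w)) p" and ?Q = "map_pmf B p"
  have "pmf_cond_entropy p A B
      = measure_pmf.expectation ?P (\<lambda>x. - log 2 (pmf ?P x / pmf ?Q (snd x)))"
    unfolding pmf_cond_entropy_eq[OF fin]
    by (subst integral_measure_pmf_real[where A = "(\<lambda>w. (A w, B w)) ` set_pmf p"])
       (use fin in \<open>auto simp: sum_negf case_prod_unfold mult.commute\<close>)
  also have "\<dots> = measure_pmf.expectation p
      (\<lambda>w. - log 2 (pmf ?P (A w, B w)) - - log 2 (pmf ?Q (B w)))"
    unfolding integral_map_pmf
  proof (rule integral_cong_AE, goal_cases)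
    case 3
    show ?case
    proof (rule AE_pmfI)
      fix w assume "w \<in> set_pmf p"
      then have "0 < pmf ?P (A w, B w)" "0 < pmf ?Q (B w)" by (auto intro!: pmf_positive)
      then show "- log 2 (pmf ?P (A w, B w) / pmf ?Q (snd (A w, B w)))
        = - log 2 (pmf ?P (A w, B w)) - - log 2 (pmf ?Q (B w))" by (simp add: log_divide)
    qed
  qed simp_all
  also have "\<dots> = ent p (\<lambda>w. (A w, B w)) - ent p B"
    unfolding ent_eq_map integral_map_pmf
    by (rule Bochner_Integration.integral_diff; rule integrable_measure_pmf_finite[OF fin])
  finally show ?thesis .
qed

lemma mutual_information_ent:
  fixes p :: "'w pmf" and A :: "'w \<Rightarrow> 'a :: countable" and B :: "'w \<Rightarrow> 'b :: countable"
  assumes fin: "finite (set_pmf p)"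
  shows "prob_space.mutual_information (measure_pmf p) 2 (count_space UNIV) (count_space UNIV) A B
    = ent p A + ent p B - ent p (\<lambda>w. (A w, B w))"
proof -
  interpret information_space "measure_pmf p" 2
    by unfold_locales simp
  have prodUNIV: "count_space (UNIV :: 'a set) \<Otimes>\<^sub>M count_space (UNIV :: 'b set) = count_space UNIV"
    by (simp add: pair_measure_countable)
  have dist: "distributed (measure_pmf p) (count_space UNIV) C (pmf (map_pmf C p))"
    for C :: "'w \<Rightarrow> 'c"
    unfolding distributed_def
    by (simp add: map_pmf_rep_eq[symmetric] measure_pmf_eq_density[symmetric])
  have sf: "sigma_finite_measure (count_space (UNIV :: 'c :: countable set))"
    by (simp add: sigma_finite_measure_count_space_countable)
  have I: "integrable p f" for f :: "_ \<Rightarrow> real"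
    by (rule integrable_measure_pmf_finite[OF fin])
  let ?P = "map_pmf (\<lambda>w. (A w, B w)) p" and ?A = "map_pmf A p" and ?B = "map_pmf B p"
  have "prob_space.mutual_information (measure_pmf p) 2 (count_space UNIV) (count_space UNIV) A B
    = (\<integral>x. pmf ?P x * log 2 (pmf ?P x / (pmf ?A (fst x) * pmf ?B (snd x))) \<partial>count_space UNIV)"
    by (subst mutual_information_distr[OF sf sf dist _ dist _, where Pxy = "pmf ?P"])
       (simp_all add: prodUNIV dist case_prod_unfold)
  also have "\<dots> = measure_pmf.expectation p
      (\<lambda>w. (- log 2 (pmf ?A (A w)) + - log 2 (pmf ?B (B w))) - - log 2 (pmf ?P (A w, B w)))"
    unfolding integral_pmf_count_space integral_map_pmf
  proof (rule integral_cong_AE, goal_cases)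
    case 3
    show ?case
    proof (rule AE_pmfI)
      fix w assume "w \<in> set_pmf p"
      then have "0 < pmf ?P (A w, B w)" "0 < pmf ?B (B w)" "0 < pmf ?A (A w)"
        by (auto intro!: pmf_positive)
      then show "log 2 (pmf ?P (A w, B w) / (pmf ?A (fst (A w, B w)) * pmf ?B (snd (A w, B w))))
        = (- log 2 (pmf ?A (A w)) + - log 2 (pmf ?B (B w))) - - log 2 (pmf ?P (A w, B w))"
        by (simp add: log_divide log_mult)
    qed
  qed simp_all
  also have "\<dots> = ent p A + ent p B - ent p (\<lambda>w. (A w, B w))"
    unfolding ent_eq_map integral_map_pmf
    by (simp only: Bochner_Integration.integral_diff[OF I I] Bochner_Integration.integral_add[OF I I])
  finally show ?thesis .
qed

text \<open>The library defines I(A; B | C) as I(A; (B, C)) - I(A; C). Expanding both terms,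
  \<open>ent p A\<close> cancels.\<close>

lemma pmf_cond_mutual_information_ent:
  fixes p :: "'w pmf" and A :: "'w \<Rightarrow> 'a :: countable" and B :: "'w \<Rightarrow> 'b :: countable"
    and C :: "'w \<Rightarrow> 'c :: countable"
  assumes fin: "finite (set_pmf p)"
  shows "pmf_cond_mutual_information p A B C
    = ent p (\<lambda>w. (A w, C w)) + ent p (\<lambda>w. (B w, C w)) - ent p (\<lambda>w. (A w, B w, C w)) - ent p C"
proof -
  have "count_space (UNIV :: 'b set) \<Otimes>\<^sub>M count_space (UNIV :: 'c set) = count_space UNIV"
    by (simp add: pair_measure_countable)
  then show ?thesis
    unfolding pmf_cond_mutual_information_def
      prob_space.conditional_mutual_information_def[OF prob_space_measure_pmf]
    by (simp add: mutual_information_ent[OF fin])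
qed

section \<open>Submodularity of entropy\<close>

lemma prob_eq_sum_fibres:
  assumes "finite (set_pmf p)"
  shows "measure_pmf.prob p {v. C v = c} = (\<Sum>b\<in>B ` set_pmf p. measure_pmf.prob p {v. B v = b \<and> C v = c})"
proof -
  have "measure_pmf.prob p {v. C v = c} = measure_pmf.prob p (\<Union>b\<in>B ` set_pmf p. {v. B v = b \<and> C v = c})"
    by (rule measure_prob_cong_0) (auto simp: set_pmf_iff)
  also have "\<dots> = (\<Sum>b\<in>B ` set_pmf p. measure_pmf.prob p {v. B v = b \<and> C v = c})"
    by (rule measure_pmf.finite_measure_finite_Union) (use assms in \<open>auto simp: disjoint_family_on_def\<close>)
  finally show ?thesis .
qed

text \<open>Gibbs' inequality against the conditionally independent law \<open>P(a, c) P(b, c) / P(c)\<close>.\<close>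

lemma ent_submodular:
  assumes fin: "finite (set_pmf p)"
  shows "ent p (\<lambda>w. (A w, B w, C w)) + ent p C \<le> ent p (\<lambda>w. (A w, C w)) + ent p (\<lambda>w. (B w, C w))"
proof -
  define S where "S = set_pmf p"
  have S: "finite S" using fin by (simp add: S_def)
  define ABC where "ABC a b c = measure_pmf.prob p {v. A v = a \<and> B v = b \<and> C v = c}" for a b c
  define AC where "AC a c = measure_pmf.prob p {v. A v = a \<and> C v = c}" for a c
  define BC where "BC b c = measure_pmf.prob p {v. B v = b \<and> C v = c}" for b c
  define PC where "PC c = measure_pmf.prob p {v. C v = c}" for c
  have nn: "0 \<le> ABC a b c" "0 \<le> AC a c" "0 \<le> BC b c" "0 \<le> PC c" for a b c
    by (simp_all add: ABC_def AC_def BC_def PC_def)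
  have pos: "0 < ABC (A w) (B w) (C w)" "0 < AC (A w) (C w)" "0 < BC (B w) (C w)" "0 < PC (C w)"
    if "w \<in> S" for w
    using that prob_eq_pos[of w p "\<lambda>w. (A w, B w, C w)"] prob_eq_pos[of w p "\<lambda>w. (A w, C w)"]
      prob_eq_pos[of w p "\<lambda>w. (B w, C w)"] prob_eq_pos[of w p C]
    by (auto simp: S_def ABC_def AC_def BC_def PC_def)
  define h where "h a b c = AC a c * BC b c / PC c" for a b c
  have hnn: "0 \<le> h a b c" for a b c using nn by (simp add: h_def)
  have E: "ent p D = (\<Sum>w\<in>S. pmf p w * - log 2 (measure_pmf.prob p {v. D v = D w}))" for D :: "'a \<Rightarrow> 'z"
    unfolding ent_def by (subst integral_measure_pmf_real[where A = S]) (use fin in \<open>auto simp: S_def mult.commute\<close>)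
  have "ent p (\<lambda>w. (A w, B w, C w)) + ent p C - ent p (\<lambda>w. (A w, C w)) - ent p (\<lambda>w. (B w, C w))
    = (\<Sum>w\<in>S. pmf p w * log 2 (h (A w) (B w) (C w) / ABC (A w) (B w) (C w)))"
    unfolding E sum_subtractf[symmetric] sum.distrib[symmetric]
  proof (rule sum.cong)
    fix w assume "w \<in> S"
    note pos[OF this]
    then show "pmf p w * - log 2 (measure_pmf.prob p {v. (A v, B v, C v) = (A w, B w, C w)}) +
        pmf p w * - log 2 (measure_pmf.prob p {v. C v = C w}) -
        pmf p w * - log 2 (measure_pmf.prob p {v. (A v, C v) = (A w, C w)}) -
        pmf p w * - log 2 (measure_pmf.prob p {v. (B v, C v) = (B w, C w)}) =
        pmf p w * log 2 (h (A w) (B w) (C w) / ABC (A w) (B w) (C w))"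
      by (simp add: h_def log_mult log_divide ABC_def[symmetric] AC_def[symmetric]
          BC_def[symmetric] PC_def[symmetric] algebra_simps)
  qed simp
  \<comment> \<open>The logarithm is bounded by its tangent, ln t \<le> t - 1; it remains to see
    that the expected ratio is at most 1.\<close>
  also have "\<dots> \<le> (\<Sum>w\<in>S. pmf p w * ((h (A w) (B w) (C w) / ABC (A w) (B w) (C w) - 1) / ln 2))"
  proof (intro sum_mono mult_left_mono)
    fix w assume "w \<in> S"
    note pos[OF this]
    then show "log 2 (h (A w) (B w) (C w) / ABC (A w) (B w) (C w))
      \<le> (h (A w) (B w) (C w) / ABC (A w) (B w) (C w) - 1) / ln 2"
      unfolding log_def by (intro divide_right_mono ln_le_minus_one) (auto simp: h_def)
  qed simp
  also have "\<dots> = ((\<Sum>w\<in>S. pmf p w * (h (A w) (B w) (C w) / ABC (A w) (B w) (C w))) - (\<Sum>w\<in>S. pmf p w)) / ln 2"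
    by (simp add: sum_subtractf[symmetric] sum_divide_distrib algebra_simps diff_divide_distrib)
  also have "(\<Sum>w\<in>S. pmf p w) = 1"
    by (rule sum_pmf_eq_1) (use fin in \<open>auto simp: S_def\<close>)
  also have "(\<Sum>w\<in>S. pmf p w * (h (A w) (B w) (C w) / ABC (A w) (B w) (C w))) \<le> 1"
  proof -
    \<comment> \<open>Sample points are grouped by their values (a, b, c). A group has total mass
      \<open>ABC a b c\<close>, which cancels the denominator and leaves
      \<open>h a b c\<close>.\<close>
    let ?T = "(\<lambda>w. (A w, B w, C w)) ` S"
    have "(\<Sum>w\<in>S. pmf p w * (h (A w) (B w) (C w) / ABC (A w) (B w) (C w)))
      = (\<Sum>t\<in>?T. \<Sum>w\<in>{w\<in>S. (A w, B w, C w) = t}. pmf p w * (h (A w) (B w) (C w) / ABC (A w) (B w) (C w)))"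
      by (rule sum.image_gen) (rule S)
    also have "\<dots> = (\<Sum>(a, b, c)\<in>?T. h a b c)"
    proof (rule sum.cong, rule refl)
      fix t assume "t \<in> ?T"
      then obtain w0 where w0: "w0 \<in> S" "t = (A w0, B w0, C w0)" by auto
      let ?W = "{w\<in>S. (A w, B w, C w) = t}"
      have "(\<Sum>w\<in>?W. pmf p w) = measure_pmf.prob p ?W"
        by (rule measure_measure_pmf_finite[symmetric]) (use S in simp)
      also have "\<dots> = ABC (A w0) (B w0) (C w0)"
        unfolding ABC_def by (rule measure_prob_cong_0) (auto simp: w0(2) S_def set_pmf_iff)
      finally have s: "(\<Sum>w\<in>?W. pmf p w) = ABC (A w0) (B w0) (C w0)" .
      have "(\<Sum>w\<in>?W. pmf p w * (h (A w) (B w) (C w) / ABC (A w) (B w) (C w)))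
        = (\<Sum>w\<in>?W. pmf p w * (h (A w0) (B w0) (C w0) / ABC (A w0) (B w0) (C w0)))"
        by (rule sum.cong) (auto simp: w0(2))
      also have "\<dots> = h (A w0) (B w0) (C w0)"
        unfolding sum_distrib_right[symmetric] s using pos(1)[OF w0(1)] by simp
      finally show "(\<Sum>w\<in>?W. pmf p w * (h (A w) (B w) (C w) / ABC (A w) (B w) (C w)))
        = (case t of (a, b, c) \<Rightarrow> h a b c)" by (simp add: w0(2))
    qed
    \<comment> \<open>Enlarging the index set to the full product adds nonnegative terms; there
      \<open>h\<close> can be summed over a and b separately, each sum giving
      \<open>PC c\<close>.\<close>
    also have "\<dots> \<le> (\<Sum>(a, b, c)\<in>A ` S \<times> B ` S \<times> C ` S. h a b c)"
      by (rule sum_mono2) (auto simp: S hnn)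
    also have "\<dots> = (\<Sum>a\<in>A ` S. \<Sum>b\<in>B ` S. \<Sum>c\<in>C ` S. h a b c)"
      by (simp add: sum.cartesian_product)
    also have "\<dots> = (\<Sum>a\<in>A ` S. \<Sum>c\<in>C ` S. \<Sum>b\<in>B ` S. h a b c)"
      by (intro sum.cong refl sum.swap)
    also have "\<dots> = (\<Sum>c\<in>C ` S. \<Sum>a\<in>A ` S. \<Sum>b\<in>B ` S. h a b c)"
      by (rule sum.swap)
    also have "\<dots> = (\<Sum>c\<in>C ` S. PC c)"
    proof (rule sum.cong, rule refl)
      fix c assume "c \<in> C ` S"
      then have "0 < PC c" using pos(4) by auto
      moreover have "(\<Sum>a\<in>A ` S. \<Sum>b\<in>B ` S. h a b c) = PC c * PC c / PC c"
        unfolding h_def sum_divide_distrib[symmetric] sum_distrib_left[symmetric] sum_distrib_right[symmetric]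
        unfolding AC_def BC_def PC_def S_def
        using prob_eq_sum_fibres[OF fin, of C c A] prob_eq_sum_fibres[OF fin, of C c B] by simp
      ultimately show "(\<Sum>a\<in>A ` S. \<Sum>b\<in>B ` S. h a b c) = PC c" by simp
    qed
    also have "\<dots> = 1"
      \<comment> \<open>With a constant variable in the role of \<open>C\<close>, the fibre sum is
        the total mass.\<close>
      using prob_eq_sum_fibres[OF fin, of "\<lambda>_. ()" "()" C] by (simp add: PC_def S_def)
    finally show ?thesis .
  qed
  finally show ?thesis by (simp add: divide_right_mono)
qed

section \<open>Local randomness: outputs of stochastic kernels\<close>

text \<open>On \<open>W\<close> the kernel always receives the same input \<open>x\<close>, so its
  output is independent of the position within \<open>W\<close>. Singletons and whole fibres of
  \<open>g\<close> are the cases of interest.\<close>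

lemma prob_kernel:
  fixes q :: "'w pmf" and K :: "'x \<Rightarrow> 'u pmf" and g :: "'w \<Rightarrow> 'x"
  defines "p \<equiv> do {w \<leftarrow> q; a \<leftarrow> K (g w); return_pmf (w, a)}"
  assumes W: "\<And>w. w \<in> W \<Longrightarrow> g w = x"
  shows "measure_pmf.prob p {(v, b). v \<in> W \<and> b = a} = measure_pmf.prob q W * pmf (K x) a"
proof -
  have *: "emeasure (map_pmf (Pair w) (K (g w))) {(v, b). v \<in> W \<and> b = a}
    = ennreal (pmf (K x) a) * indicator W w" for w
    using W[of w] by (auto simp: emeasure_pmf_single vimage_def indicator_def)
  have "emeasure p {(v, b). v \<in> W \<and> b = a} = ennreal (pmf (K x) a) * emeasure q W"
    unfolding p_def map_pmf_def[symmetric] emeasure_bind_pmf *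
    by (subst nn_integral_cmult) auto
  then show ?thesis
    by (simp add: measure_pmf.emeasure_eq_measure ennreal_mult[symmetric] mult.commute)
qed

lemma map_fst_kernel: "map_pmf fst (do {w \<leftarrow> q; a \<leftarrow> K w; return_pmf (w, a)}) = q"
  by (simp add: map_bind_pmf bind_return_pmf')

text \<open>The conditional entropy of a freshly drawn output given the whole past equals that given
  the kernel input: in both cases the conditional probability of the output is
  \<open>pmf (K (g w)) a\<close>. Conditional independence of the messages and keys enters in this
  form.\<close>

lemma ent_kernel:
  fixes q :: "'w pmf" and K :: "'x \<Rightarrow> 'u pmf" and g :: "'w \<Rightarrow> 'x"
  defines "p \<equiv> do {w \<leftarrow> q; a \<leftarrow> K (g w); return_pmf (w, a)}"
  assumes finp: "finite (set_pmf p)"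
  shows "ent p (\<lambda>w. w) - ent p fst = ent p (\<lambda>(w, a). (g w, a)) - ent p (\<lambda>(w, a). g w)"
proof -
  note p = prob_kernel[of _ g _ q K, folded p_def]
  have q: "map_pmf fst p = q"
    unfolding p_def by (rule map_fst_kernel)
  have q': "measure_pmf.prob p {v. fst v \<in> W} = measure_pmf.prob q W" for W
    by (subst q[symmetric]) (simp add: vimage_def)
  have I: "integrable p f" for f :: "_ \<Rightarrow> real"
    by (rule integrable_measure_pmf_finite[OF finp])
  \<comment> \<open>With the differences moved to the other side, the identity holds pointwise on
    the support, as a product of two probabilities on each side.\<close>
  have "ent p (\<lambda>w. w) + ent p (\<lambda>(w, a). g w) = ent p fst + ent p (\<lambda>(w, a). (g w, a))"
    unfolding ent_def Bochner_Integration.integral_add[OF I I, symmetric]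
  proof (rule integral_cong_AE, goal_cases)
    case 3
    show ?case
    proof (rule AE_pmfI)
      fix t assume t: "t \<in> set_pmf p"
      obtain w a where wa: "t = (w, a)" by force
      have 1: "measure_pmf.prob p {v. v = t} = measure_pmf.prob q {w} * pmf (K (g w)) a"
        using p[of "{w}" "g w" a] by (simp add: wa case_prod_unfold prod_eq_iff)
      have 2: "measure_pmf.prob p {v. (case v of (w, a) \<Rightarrow> (g w, a)) = (case t of (w, a) \<Rightarrow> (g w, a))}
        = measure_pmf.prob q {v. g v = g w} * pmf (K (g w)) a"
        using p[of "{v. g v = g w}" "g w" a] by (simp add: wa case_prod_unfold)
      have 3: "measure_pmf.prob p {v. fst v = fst t} = measure_pmf.prob q {w}"
        using q'[of "{w}"] by (simp add: wa)
      have 4: "measure_pmf.prob p {v. (case v of (w, a) \<Rightarrow> g w) = (case t of (w, a) \<Rightarrow> g w)}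
        = measure_pmf.prob q {v. g v = g w}"
        using q'[of "{v. g v = g w}"] by (simp add: wa case_prod_unfold)
      have "0 < measure_pmf.prob p {v. v = t}" using prob_eq_pos[OF t, of "\<lambda>x. x"] by simp
      then have "0 < pmf (K (g w)) a" unfolding 1 by (simp add: zero_less_mult_iff less_le pmf_nonneg)
      moreover have "0 < measure_pmf.prob q {w}" "0 < measure_pmf.prob q {v. g v = g w}"
        using prob_eq_pos[OF t, of fst] prob_eq_pos[OF t, of "\<lambda>(w, a). g w"] unfolding 3 4 .
      ultimately show "- log 2 (measure_pmf.prob p {v. v = t}) +
        - log 2 (measure_pmf.prob p {v. (case v of (w, a) \<Rightarrow> g w) = (case t of (w, a) \<Rightarrow> g w)}) =
        - log 2 (measure_pmf.prob p {v. fst v = fst t}) +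
        - log 2 (measure_pmf.prob p
          {v. (case v of (w, a) \<Rightarrow> (g w, a)) = (case t of (w, a) \<Rightarrow> (g w, a))})"
        unfolding 1 2 3 4 by (simp add: log_mult)
    qed
  qed simp_all
  then show ?thesis by simp
qed


section \<open>Single-letter bound by \<open>Delta1\<close>\<close>

text \<open>An auxiliary variable drawn by a kernel that reads only the first bit satisfies the
  Markov condition, so it is a candidate in the infimum. The entropy of the auxiliary variable
  cancels from the difference of conditional entropies, leaving joint ones.\<close>

lemma Delta1_le_kernel:
  fixes K :: "bool \<Rightarrow> 'u :: countable pmf" and pxy :: "(bool \<times> bool) pmf"
  defines "q \<equiv> do {xy \<leftarrow> pxy; u \<leftarrow> K (fst xy); return_pmf (xy, u)}"
  assumes fin: "finite (set_pmf q)"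
  shows "Delta1 pxy \<le> ent q (\<lambda>((x, y), u). (x \<noteq> y, u)) - ent q (\<lambda>((x, y), u). (y, u))"
proof -
  \<comment> \<open>\<open>Delta1_set\<close> admits symbols in \<open>nat\<close>; the injective
    renaming \<open>to_nat\<close> leaves all entropies unchanged.\<close>
  define K' where "K' = (\<lambda>x. map_pmf to_nat (K x))"
  define q' where "q' = do {xy \<leftarrow> pxy; u \<leftarrow> K' (fst xy); return_pmf (xy, u)}"
  have q': "q' = map_pmf (\<lambda>(xy, u). (xy, to_nat u)) q"
    by (simp add: q'_def q_def K'_def map_bind_pmf bind_map_pmf)
  have fin': "finite (set_pmf q')" using fin by (simp add: q')
  note pr = prob_kernel[of _ fst _ pxy K', folded q'_def]
  have pW: "measure_pmf.prob q' {v. fst v \<in> W} = measure_pmf.prob pxy W" for W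
    by (subst map_fst_kernel[of pxy "\<lambda>w. K' (fst w)", symmetric], fold q'_def) (simp add: vimage_def)
  have markov: "markov_chain q' (\<lambda>((x, y), u). u) (\<lambda>((x, y), u). x) (\<lambda>((x, y), u). (y, x \<noteq> y))"
    unfolding markov_chain_def
  proof (intro allI, goal_cases)
    case (1 a b c)
    have 1: "measure_pmf.prob q' {w. ((case w of ((x, y), u) \<Rightarrow> u) = a \<and>
        (case w of ((x, y), u) \<Rightarrow> (y, x \<noteq> y)) = c) \<and> (case w of ((x, y), u) \<Rightarrow> x) = b}
      = measure_pmf.prob pxy {(x, y). x = b \<and> (y, x \<noteq> y) = c} * pmf (K' b) a"
      by (subst pr[symmetric]) (auto intro!: arg_cong[where f = "measure_pmf.prob q'"])
    have 2: "measure_pmf.prob q' {w. (case w of ((x, y), u) \<Rightarrow> u) = a \<and> (case w of ((x, y), u) \<Rightarrow> x) = b}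
      = measure_pmf.prob pxy {(x, y). x = b} * pmf (K' b) a"
      by (subst pr[symmetric]) (auto intro!: arg_cong[where f = "measure_pmf.prob q'"])
    have 3: "measure_pmf.prob q' {w. (case w of ((x, y), u) \<Rightarrow> (y, x \<noteq> y)) = c \<and> (case w of ((x, y), u) \<Rightarrow> x) = b}
      = measure_pmf.prob pxy {(x, y). x = b \<and> (y, x \<noteq> y) = c}"
      by (subst pW[symmetric]) (auto intro!: arg_cong[where f = "measure_pmf.prob q'"])
    have 4: "measure_pmf.prob q' {w. (case w of ((x, y), u) \<Rightarrow> x) = b}
      = measure_pmf.prob pxy {(x, y). x = b}"
      by (subst pW[symmetric]) (auto intro!: arg_cong[where f = "measure_pmf.prob q'"])
    \<comment> \<open>Given first bit \<open>b\<close>, the symbol has probability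
      \<open>pmf (K' b) a\<close> independently of the rest. If \<open>b\<close> has probability
      zero, all quotients are 0 by division by zero.\<close>
    show ?case
      unfolding cond_prob_def using 1 2 3 4
      by (cases "measure_pmf.prob pxy {(x, y). x = b} = 0") (simp_all add: case_prod_unfold)
  qed
  have "pmf_cond_entropy q' (\<lambda>((x, y), u). x \<noteq> y) (\<lambda>((x, y), u). u)
      - pmf_cond_entropy q' (\<lambda>((x, y), u). y) (\<lambda>((x, y), u). u) \<in> Delta1_set pxy"
    unfolding Delta1_set_def using fin' markov map_fst_kernel[of pxy "\<lambda>w. K' (fst w)", folded q'_def]
    by blast
  then have "Delta1 pxy \<le> pmf_cond_entropy q' (\<lambda>((x, y), u). x \<noteq> y) (\<lambda>((x, y), u). u)
      - pmf_cond_entropy q' (\<lambda>((x, y), u). y) (\<lambda>((x, y), u). u)"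
    unfolding Delta1_def by (rule cInf_lower[OF _ Delta1_set_bdd_below])
  also have "\<dots> = ent q' (\<lambda>((x, y), u). (x \<noteq> y, u)) - ent q' (\<lambda>((x, y), u). (y, u))"
    unfolding pmf_cond_entropy_ent[OF fin'] by (simp add: case_prod_unfold)
  also have "ent q' (\<lambda>((x, y), u). (x \<noteq> y, u)) = ent q (\<lambda>((x, y), u). (x \<noteq> y, u))"
    unfolding q' ent_map by (rule ent_cong) auto
  also have "ent q' (\<lambda>((x, y), u). (y, u)) = ent q (\<lambda>((x, y), u). (y, u))"
    unfolding q' ent_map by (rule ent_cong) auto
  finally show ?thesis .
qed

lemma finite_set_replicate_pmf:
  assumes "finite (set_pmf p)"
  shows "finite (set_pmf (replicate_pmf n p))"
  using finite_lists_length_eq[OF assms, of n] by (simp add: set_replicate_pmf lists_eq_set conj_commute)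

lemma Delta1_single_letter:
  fixes pxy :: "(bool \<times> bool) pmf" and G :: "bool list \<Rightarrow> 'f :: finite pmf" and n :: nat
  defines "r \<equiv> do {xys \<leftarrow> replicate_pmf n pxy; f \<leftarrow> G (map fst xys); return_pmf (xys, f)}"
  shows "real n * Delta1 pxy \<le> ent r (\<lambda>(xys, f). (map (\<lambda>(x, y). x \<noteq> y) xys, f))
    - ent r (\<lambda>(xys, f). (map snd xys, f))"
proof -
  define Z :: "bool \<times> bool \<Rightarrow> bool" where "Z = (\<lambda>(x, y). x \<noteq> y)"
  have finr: "finite (set_pmf r)"
    unfolding r_def by (auto intro!: finite_set_replicate_pmf finite_set_pmf_bool)
  have len: "length xys = n" if "(xys, f) \<in> set_pmf r" for xys f
    using that by (auto simp: r_def set_replicate_pmf)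
  \<comment> \<open>A hybrid between the two sides: Z on the first \<open>i\<close> coordinates and
    Y on the others. The ends \<open>T 0\<close> and \<open>T n\<close> are the two entropies to be
    compared.\<close>
  define T where "T i = ent r (\<lambda>(xys, f). (map Z (take i xys), map snd (drop i xys), f))" for i
  \<comment> \<open>Csiszar's identity telescopes over \<open>i\<close>, with auxiliary variable
    \<open>U\<^sub>i = (Z\<^sub>1, \<dots>, Z\<^sub>i\<^sub>-\<^sub>1, Y\<^sub>i\<^sub>+\<^sub>1, \<dots>, Y\<^sub>n, F)\<close>; given \<open>X\<^sub>i\<close> it depends
    on coordinates other than \<open>i\<close> only.\<close>
  have step: "Delta1 pxy \<le> T (Suc i) - T i" if i: "i < n" for i
  proof -
    obtain m where m: "n = i + Suc m" using i less_iff_Suc_add by auto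
    \<comment> \<open>The law of the auxiliary variable given that the first bit at index
      \<open>i\<close> (counted from 0) is \<open>x\<close>: the other coordinates are drawn afresh,
      and the message sees index \<open>i\<close> only through \<open>x\<close>.\<close>
    define K where "K x = do {as \<leftarrow> replicate_pmf i pxy; bs \<leftarrow> replicate_pmf m pxy;
      f \<leftarrow> G (map fst as @ x # map fst bs); return_pmf (map Z as, map snd bs, f)}" for x
    define U where "U = (\<lambda>(xys, f :: 'f). (xys ! i, map Z (take i xys), map snd (drop (Suc i) xys), f))"
    define q where "q = do {xy \<leftarrow> pxy; u \<leftarrow> K (fst xy); return_pmf (xy, u)}"
    \<comment> \<open>\<open>T (Suc i)\<close> and \<open>T i\<close> both consist of the auxiliary
      variable and one bit at index \<open>i\<close>, which is Z in the former and Y in the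
      latter.\<close>
    have t: "map Z (take (Suc i) xys) = map Z (take i xys) @ [Z (xys ! i)]"
      "map snd (drop i xys) = snd (xys ! i) # map snd (drop (Suc i) xys)"
      if "(xys, f) \<in> set_pmf r" for xys f
      using len[OF that] i by (simp_all add: take_Suc_conv_app_nth Cons_nth_drop_Suc[symmetric])
    have "map_pmf U r = do {as \<leftarrow> replicate_pmf i pxy; xy \<leftarrow> pxy; bs \<leftarrow> replicate_pmf m pxy;
      f \<leftarrow> G (map fst as @ fst xy # map fst bs); return_pmf (xy, map Z as, map snd bs, f)}"
      unfolding r_def m replicate_pmf_distrib
      by (auto simp: map_bind_pmf bind_assoc_pmf bind_return_pmf U_def set_replicate_pmf nth_append
          intro!: bind_pmf_cong)
    \<comment> \<open>The coordinates are independent, so the one at index \<open>i\<close> may be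
      drawn first and the rest absorbed into the kernel.\<close>
    also have "\<dots> = q"
      unfolding q_def K_def
      by (subst bind_commute_pmf) (simp add: bind_assoc_pmf bind_return_pmf)
    finally have q: "q = map_pmf U r" ..
    have "Delta1 pxy \<le> ent q (\<lambda>((x, y), u). (x \<noteq> y, u)) - ent q (\<lambda>((x, y), u). (y, u))"
      unfolding q_def by (rule Delta1_le_kernel, fold q_def) (simp add: q finr)
    also have "ent q (\<lambda>((x, y), u). (x \<noteq> y, u)) = ent r (\<lambda>w. (Z (fst (U w)), snd (U w)))"
      unfolding q ent_map by (simp add: Z_def case_prod_unfold)
    also have "\<dots> = T (Suc i)"
      unfolding T_def
      by (rule ent_cong, clarify, simp add: U_def t) blast
    also have "ent q (\<lambda>((x, y), u). (y, u)) = ent r (\<lambda>w. (snd (fst (U w)), snd (U w)))"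
      unfolding q ent_map by (simp add: case_prod_unfold)
    also have "\<dots> = T i"
      unfolding T_def
      by (rule ent_cong, clarify, simp add: U_def t) blast
    finally show ?thesis .
  qed
  have "real i * Delta1 pxy \<le> T i - T 0" if "i \<le> n" for i
    using that
  proof (induction i)
    case (Suc i)
    then show ?case using step[of i] by (simp add: algebra_simps)
  qed simp
  from this[OF order_refl] have "real n * Delta1 pxy \<le> T n - T 0" .
  also have "T n = ent r (\<lambda>(xys, f). (map (\<lambda>(x, y). x \<noteq> y) xys, f))"
    unfolding T_def Z_def by (rule ent_cong, clarify, simp add: len)
  also have "T 0 = ent r (\<lambda>(xys, f). (map snd xys, f))"
    unfolding T_def by (rule ent_cong) auto
  finally show ?thesis .
qed

section \<open>The bound with \<open>Delta1\<close> for a code\<close>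

lemma finite_set_code_law:
  fixes PF1 :: "bool list \<Rightarrow> 'f1 :: finite pmf"
    and PF2 :: "bool list \<Rightarrow> 'f2 :: finite pmf"
    and PKA :: "bool list \<Rightarrow> 'f1 \<Rightarrow> 'f2 \<Rightarrow> 'ka :: finite pmf"
    and PKB :: "bool list \<Rightarrow> 'f1 \<Rightarrow> 'f2 \<Rightarrow> 'kb :: finite pmf"
  shows "finite (set_pmf (code_law n pxy PF1 PF2 PKA PKB))"
  unfolding code_law_def Let_def by (auto intro!: finite_set_replicate_pmf finite_set_pmf_bool)

lemma code_law_lengths:
  assumes "(xs, ys, f1, f2, ka, kb) \<in> set_pmf (code_law n pxy PF1 PF2 PKA PKB)"
  shows "length xs = n \<and> length ys = n"
  using assms unfolding code_law_def Let_def by (auto simp: set_replicate_pmf)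

text \<open>Exclusive or with a fixed list is injective on lists of its length. Hence the pair of Y
  and Z sequences carries the same information as the pair of X and Y sequences.\<close>

lemma map2_xor_cancel:
  fixes xs ys xs' :: "bool list"
  shows "length xs = length ys \<Longrightarrow> length xs' = length ys \<Longrightarrow>
    map2 (\<noteq>) xs' ys = map2 (\<noteq>) xs ys \<longleftrightarrow> xs' = xs"
proof (induction xs ys arbitrary: xs' rule: list_induct2)
  case (Cons x xs y ys)
  then show ?case by (cases xs') auto
qed simp

text \<open>This treats Alice and Bob asymmetrically and is stated for arbitrary alphabets and
  kernels, so that it can be applied a second time to the code with the two parties
  exchanged.\<close>

lemma one_sided_bound:
  fixes pxy :: "(bool \<times> bool) pmf" and n :: nat
    and PF1 :: "bool list \<Rightarrow> 'f1 :: finite pmf"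
    and PF2 :: "bool list \<Rightarrow> 'f2 :: finite pmf"
    and PKA :: "bool list \<Rightarrow> 'f1 \<Rightarrow> 'f2 \<Rightarrow> 'ka :: finite pmf"
    and PKB :: "bool list \<Rightarrow> 'f1 \<Rightarrow> 'f2 \<Rightarrow> 'kb :: finite pmf"
  defines "P \<equiv> code_law n pxy PF1 PF2 PKA PKB"
    and "Zn \<equiv> (\<lambda>(xs, ys, f1, f2, ka, kb). map2 (\<noteq>) xs ys)"
    and "F \<equiv> (\<lambda>(xs, ys, f1, f2, ka, kb). (f1, f2))"
    and "KA \<equiv> (\<lambda>(xs, ys, f1, f2, ka, kb). ka)"
    and "KB \<equiv> (\<lambda>(xs, ys, f1, f2, ka, kb). kb)"
  shows "real n * Delta1 pxy + pmf_cond_mutual_information P KA KB F \<le> 2 * pmf_cond_entropy P Zn F"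
proof -
  define X Y F1 F2 where "X = (\<lambda>(xs :: bool list, ys :: bool list, f1 :: 'f1, f2 :: 'f2, ka :: 'ka, kb :: 'kb). xs)"
    and "Y = (\<lambda>(xs :: bool list, ys :: bool list, f1 :: 'f1, f2 :: 'f2, ka :: 'ka, kb :: 'kb). ys)"
    and "F1 = (\<lambda>(xs :: bool list, ys :: bool list, f1 :: 'f1, f2 :: 'f2, ka :: 'ka, kb :: 'kb). f1)"
    and "F2 = (\<lambda>(xs :: bool list, ys :: bool list, f1 :: 'f1, f2 :: 'f2, ka :: 'ka, kb :: 'kb). f2)"
  note defs = X_def Y_def F1_def F2_def KA_def KB_def F_def Zn_def
  have fin: "finite (set_pmf P)" unfolding P_def by (rule finite_set_code_law)
  have F: "F w = (F1 w, F2 w)" for w by (simp add: defs case_prod_unfold)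

  define R where "R = do {xys \<leftarrow> replicate_pmf n pxy; f \<leftarrow> PF1 (map fst xys); return_pmf (xys, f)}"
  have "map_pmf (\<lambda>(xys, f). (map fst xys, map snd xys, f)) R = map_pmf (\<lambda>w. (X w, Y w, F1 w)) P"
    by (simp add: R_def P_def code_law_def Let_def map_bind_pmf defs)
  note R = arg_cong[OF this, of "\<lambda>p. ent p h" for h, unfolded ent_map case_prod_unfold fst_conv snd_conv]
  have "real n * Delta1 pxy \<le> ent R (\<lambda>(xys, f). (map (\<lambda>(x, y). x \<noteq> y) xys, f))
      - ent R (\<lambda>(xys, f). (map snd xys, f))"
    unfolding R_def by (rule Delta1_single_letter)
  also have "ent R (\<lambda>(xys, f). (map snd xys, f)) = ent P (\<lambda>w. (Y w, F1 w))"
    using R[of "\<lambda>(x, y, f). (y, f)"] by (simp add: case_prod_unfold)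
  also have "ent R (\<lambda>(xys, f). (map (\<lambda>(x, y). x \<noteq> y) xys, f)) = ent P (\<lambda>w. (Zn w, F1 w))"
    using R[of "\<lambda>(x, y, f). (map2 (\<noteq>) x y, f)"]
    by (simp add: case_prod_unfold zip_map_fst_snd defs)
  finally have Delta: "real n * Delta1 pxy \<le> ent P (\<lambda>w. (Zn w, F1 w)) - ent P (\<lambda>w. (Y w, F1 w))" .

  \<comment> \<open>Bob's message is drawn from Y alone: H(F2 | X, Y, F1) = H(F2 | Y).\<close>
  define Q2 where "Q2 = map_pmf (\<lambda>w. (X w, Y w, F1 w)) P"
  define S2 where "S2 = map_pmf (\<lambda>w. ((X w, Y w, F1 w), F2 w)) P"
  have S2: "S2 = do {w \<leftarrow> Q2; a \<leftarrow> PF2 ((\<lambda>(x, y, f). y) w); return_pmf (w, a)}"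
    by (simp add: S2_def Q2_def P_def code_law_def Let_def map_bind_pmf bind_map_pmf bind_assoc_pmf bind_return_pmf defs)
  have "finite (set_pmf S2)" by (simp add: S2_def fin)
  from ent_kernel[of Q2 PF2 "\<lambda>(x, y, f). y", folded S2, OF this]
  have k2: "ent P (\<lambda>w. ((X w, Y w, F1 w), F2 w)) - ent P (\<lambda>w. (X w, Y w, F1 w))
    = ent P (\<lambda>w. (Y w, F2 w)) - ent P Y"
    unfolding S2_def ent_map by simp

  \<comment> \<open>Bob's key is drawn from Y and the messages: H(KB | X, Y, F1, F2, KA) = H(KB | Y,
    F1, F2).\<close>
  define QB where "QB = map_pmf (\<lambda>w. (X w, Y w, F1 w, F2 w, KA w)) P"
  define SB where "SB = map_pmf (\<lambda>w. ((X w, Y w, F1 w, F2 w, KA w), KB w)) P"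
  have SB: "SB = do {w \<leftarrow> QB; a \<leftarrow> (\<lambda>(y, f1, f2). PKB y f1 f2) ((\<lambda>(x, y, f1, f2, ka). (y, f1, f2)) w);
      return_pmf (w, a)}"
    by (simp add: SB_def QB_def P_def code_law_def Let_def map_bind_pmf bind_map_pmf bind_assoc_pmf bind_return_pmf defs)
  have "finite (set_pmf SB)" by (simp add: SB_def fin)
  from ent_kernel[of QB "\<lambda>(y, f1, f2). PKB y f1 f2" "\<lambda>(x, y, f1, f2, ka). (y, f1, f2)", folded SB, OF this]
  have kB: "ent P (\<lambda>w. ((X w, Y w, F1 w, F2 w, KA w), KB w)) - ent P (\<lambda>w. (X w, Y w, F1 w, F2 w, KA w))
    = ent P (\<lambda>w. ((Y w, F1 w, F2 w), KB w)) - ent P (\<lambda>w. (Y w, F1 w, F2 w))"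
    unfolding SB_def ent_map by simp

  have len: "length (X w) = n" "length (Y w) = n" if "w \<in> set_pmf P" for w
    using that unfolding P_def by (cases w; auto simp: X_def Y_def dest: code_law_lengths)+
  have Z: "Zn w = map2 (\<noteq>) (X w) (Y w)" for w
    by (simp add: Zn_def X_def Y_def case_prod_unfold)
  have YZ: "Y v = Y w \<and> Zn v = Zn w \<longleftrightarrow> X v = X w \<and> Y v = Y w"
    if "v \<in> set_pmf P" "w \<in> set_pmf P" for v w
    using map2_xor_cancel[of "X w" "Y w" "X v"] len[OF that(1)] len[OF that(2)]
    unfolding Z by metis

  \<comment> \<open>The chain is H(F2 | Y, F1) \<le> H(F2 | Y) = H(F2 | X, Y, F1) = H(F2 | Y, Zn,
    F1) \<le> H(F2 | Zn, F1), with \<open>k2\<close> as the first equality and \<open>YZ\<close>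
    behind the second. So adjoining F2 raises the entropy of (Zn, F1) at least as much as that of
    (Y, F1).\<close>
  have "ent P (\<lambda>w. (F2 w, F1 w, Y w)) + ent P Y \<le> ent P (\<lambda>w. (F2 w, Y w)) + ent P (\<lambda>w. (F1 w, Y w))"
    by (rule ent_submodular[OF fin])
  moreover have "ent P (\<lambda>w. (F2 w, Y w, Zn w, F1 w)) + ent P (\<lambda>w. (Zn w, F1 w))
    \<le> ent P (\<lambda>w. (F2 w, Zn w, F1 w)) + ent P (\<lambda>w. (Y w, Zn w, F1 w))"
    by (rule ent_submodular[OF fin])
  moreover have "ent P (\<lambda>w. (F2 w, Y w, Zn w, F1 w)) = ent P (\<lambda>w. ((X w, Y w, F1 w), F2 w))"
    by (rule ent_cong, simp only: prod.inject) (metis YZ)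
  moreover have "ent P (\<lambda>w. (Y w, Zn w, F1 w)) = ent P (\<lambda>w. (X w, Y w, F1 w))"
    by (rule ent_cong, simp only: prod.inject) (metis YZ)
  moreover have "ent P (\<lambda>w. (F2 w, Zn w, F1 w)) = ent P (\<lambda>w. (Zn w, F w))"
    by (rule ent_cong) (auto simp: F)
  moreover have "ent P (\<lambda>w. (F2 w, F1 w, Y w)) = ent P (\<lambda>w. (Y w, F1 w, F2 w))"
    by (rule ent_cong) auto
  moreover have "ent P (\<lambda>w. (F2 w, Y w)) = ent P (\<lambda>w. (Y w, F2 w))"
    by (rule ent_cong) auto
  moreover have "ent P (\<lambda>w. (F1 w, Y w)) = ent P (\<lambda>w. (Y w, F1 w))"
    by (rule ent_cong) auto
  ultimately have ZY: "ent P (\<lambda>w. (Zn w, F1 w)) - ent P (\<lambda>w. (Y w, F1 w))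
    \<le> ent P (\<lambda>w. (Zn w, F w)) - ent P (\<lambda>w. (Y w, F1 w, F2 w))"
    using k2 by linarith

  \<comment> \<open>Conditioning further on X and Y and using \<open>kB\<close> gives H(KB | KA, F)
    \<ge> H(KB | Y, F). Hence I(KA; KB | F) \<le> I(Y; KB | F) \<le> H(Y | F).\<close>
  have "ent P (\<lambda>w. (KB w, (X w, Y w), KA w, F w)) + ent P (\<lambda>w. (KA w, F w))
    \<le> ent P (\<lambda>w. (KB w, KA w, F w)) + ent P (\<lambda>w. ((X w, Y w), KA w, F w))"
    by (rule ent_submodular[OF fin])
  moreover have "ent P (\<lambda>w. (KB w, (X w, Y w), KA w, F w)) = ent P (\<lambda>w. ((X w, Y w, F1 w, F2 w, KA w), KB w))"
    by (rule ent_cong) (auto simp: F)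
  moreover have "ent P (\<lambda>w. ((X w, Y w), KA w, F w)) = ent P (\<lambda>w. (X w, Y w, F1 w, F2 w, KA w))"
    by (rule ent_cong) (auto simp: F)
  moreover have "ent P (\<lambda>w. (KB w, KA w, F w)) = ent P (\<lambda>w. (KA w, KB w, F w))"
    by (rule ent_cong) auto
  moreover have "ent P (\<lambda>w. (KB w, F w)) \<le> ent P (\<lambda>w. ((Y w, F1 w, F2 w), KB w))"
    by (rule ent_mono[OF fin]) (auto simp: F)
  ultimately have I: "pmf_cond_mutual_information P KA KB F \<le> ent P (\<lambda>w. (Y w, F1 w, F2 w)) - ent P F"
    unfolding pmf_cond_mutual_information_ent[OF fin] using kB by linarith

  \<comment> \<open>Nonnegativity of H(Zn | F); adding it to the next inequality produces the factor
    2.\<close>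
  have "ent P F \<le> ent P (\<lambda>w. (Zn w, F w))"
    by (rule ent_mono[OF fin]) auto
  moreover have "real n * Delta1 pxy + pmf_cond_mutual_information P KA KB F
    \<le> ent P (\<lambda>w. (Zn w, F w)) - ent P F"
    using add_mono[OF order_trans[OF Delta ZY] I] by simp
  moreover have "pmf_cond_entropy P Zn F = ent P (\<lambda>w. (Zn w, F w)) - ent P F"
    by (rule pmf_cond_entropy_ent[OF fin])
  ultimately show ?thesis by linarith
qed

section \<open>Exchanging Alice and Bob\<close>

lemma replicate_pmf_map: "replicate_pmf n (map_pmf h p) = map_pmf (map h) (replicate_pmf n p)"
  by (induction n) (simp_all add: map_bind_pmf bind_map_pmf)

text \<open>The two messages are drawn independently given the sources, and the two keys
  independently given sources and messages, so each pair of draws may be interchanged.\<close>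

lemma code_law_swap:
  "code_law n (map_pmf prod.swap pxy) PF2 PF1 (\<lambda>ys f2 f1. PKB ys f1 f2) (\<lambda>xs f2 f1. PKA xs f1 f2)
    = map_pmf (\<lambda>(xs, ys, f1, f2, ka, kb). (ys, xs, f2, f1, kb, ka)) (code_law n pxy PF1 PF2 PKA PKB)"
proof -
  have 1: "bind_pmf (PF2 ys) (\<lambda>f2. bind_pmf (PF1 xs) (\<lambda>f1. bind_pmf (PKB ys f1 f2)
      (\<lambda>kb. bind_pmf (PKA xs f1 f2) (\<lambda>ka. return_pmf (ys, xs, f2, f1, kb, ka)))))
    = bind_pmf (PF1 xs) (\<lambda>f1. bind_pmf (PF2 ys) (\<lambda>f2. bind_pmf (PKA xs f1 f2)
      (\<lambda>ka. bind_pmf (PKB ys f1 f2) (\<lambda>kb. return_pmf (ys, xs, f2, f1, kb, ka)))))" for xs ys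
    by (subst bind_commute_pmf, intro bind_pmf_cong refl, subst bind_commute_pmf, rule refl)
  show ?thesis
    by (simp add: code_law_def Let_def replicate_pmf_map map_bind_pmf bind_map_pmf comp_def)
       (intro bind_pmf_cong refl 1)
qed

text \<open>Swapping the source bits maps every candidate for \<open>Delta1\<close> of the swapped
  source to a candidate for \<open>Delta2\<close> with the same value, and the infimum over a larger
  set is smaller.\<close>

lemma Delta2_le_swap: "Delta2 pxy \<le> Delta1 (map_pmf prod.swap pxy)"
  unfolding Delta1_def Delta2_def
proof (rule cInf_superset_mono[OF Delta1_set_nonempty Delta2_set_bdd_below], rule subsetI)
  fix d assume "d \<in> Delta1_set (map_pmf prod.swap pxy)"
  then obtain q :: "((bool \<times> bool) \<times> nat) pmf" where fin: "finite (set_pmf q)"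
    and q: "map_pmf fst q = map_pmf prod.swap pxy"
    and markov: "markov_chain q (\<lambda>((x, y), u). u) (\<lambda>((x, y), u). x) (\<lambda>((x, y), u). (y, x \<noteq> y))"
    and d: "d = pmf_cond_entropy q (\<lambda>((x, y), u). x \<noteq> y) (\<lambda>((x, y), u). u)
      - pmf_cond_entropy q (\<lambda>((x, y), u). y) (\<lambda>((x, y), u). u)"
    unfolding Delta1_set_def by blast
  have xor: "(\<lambda>((x, y), u). (y, x \<noteq> y)) = (\<lambda>((x :: bool, y), u :: nat). (y, y \<noteq> x))"
    by auto
  define q' where "q' = map_pmf (\<lambda>((x, y), u). ((y, x), u)) q"
  have fin': "finite (set_pmf q')" using fin by (simp add: q'_def)
  have "map_pmf fst q' = map_pmf prod.swap (map_pmf fst q)"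
    unfolding q'_def by (simp add: map_pmf_comp case_prod_unfold prod.swap_def)
  then have 1: "map_pmf fst q' = pxy" by (simp add: q map_pmf_comp)
  have 2: "markov_chain q' (\<lambda>((x, y), v). v) (\<lambda>((x, y), v). y) (\<lambda>((x, y), v). (x, x \<noteq> y))"
    using markov unfolding q'_def markov_chain_map_pmf xor by (simp add: case_prod_unfold)
  have "d = pmf_cond_entropy q' (\<lambda>((x, y), v). x \<noteq> y) (\<lambda>((x, y), v). v)
      - pmf_cond_entropy q' (\<lambda>((x, y), v). x) (\<lambda>((x, y), v). v)"
    unfolding d pmf_cond_entropy_ent[OF fin'] pmf_cond_entropy_ent[OF fin]
    unfolding q'_def ent_map
    by (intro arg_cong2[where f = "(-)"] ent_cong) auto
  then show "d \<in> Delta2_set pxy"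
    unfolding Delta2_set_def using fin' 1 2 by blast
qed

theorem theorem7:
  fixes pxy :: "(bool \<times> bool) pmf" and n :: nat
    and PF1 :: "bool list \<Rightarrow> 'f1 :: finite pmf"
    and PF2 :: "bool list \<Rightarrow> 'f2 :: finite pmf"
    and PKA :: "bool list \<Rightarrow> 'f1 \<Rightarrow> 'f2 \<Rightarrow> 'ka :: finite pmf"
    and PKB :: "bool list \<Rightarrow> 'f1 \<Rightarrow> 'f2 \<Rightarrow> 'kb :: finite pmf"
  defines "P \<equiv> code_law n pxy PF1 PF2 PKA PKB"
    and "Zn \<equiv> (\<lambda>(xs, ys, f1, f2, ka, kb). map2 (\<noteq>) xs ys)"
    and "F \<equiv> (\<lambda>(xs, ys, f1, f2, ka, kb). (f1, f2))"
    and "KA \<equiv> (\<lambda>(xs, ys, f1, f2, ka, kb). ka)"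
    and "KB \<equiv> (\<lambda>(xs, ys, f1, f2, ka, kb). kb)"
  assumes "n \<ge> 1"
  shows "1 / real n * pmf_cond_entropy P Zn F
           \<ge> Delta_bar pxy / 2 + pmf_cond_mutual_information P KA KB F / (2 * real n)"
proof -
  have fin: "finite (set_pmf P)" unfolding P_def by (rule finite_set_code_law)
  have 1: "real n * Delta1 pxy + pmf_cond_mutual_information P KA KB F \<le> 2 * pmf_cond_entropy P Zn F"
    unfolding P_def Zn_def F_def KA_def KB_def by (rule one_sided_bound)
  \<comment> \<open>The code is read with the parties exchanged. Exclusive or is symmetric, so the Z
    sequence is unchanged, and only the order within the public pair differs, which entropy does not
    see.\<close>
  define swap where "swap = (\<lambda>(xs :: bool list, ys :: bool list, f1 :: 'f1, f2 :: 'f2, ka :: 'ka, kb :: 'kb).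
    (ys, xs, f2, f1, kb, ka))"
  define P' where "P' = map_pmf swap P"
  define Zn' F' KA' KB' where
    "Zn' = (\<lambda>(ys :: bool list, xs :: bool list, f2 :: 'f2, f1 :: 'f1, kb :: 'kb, ka :: 'ka). map2 (\<noteq>) ys xs)"
    and "F' = (\<lambda>(ys :: bool list, xs :: bool list, f2 :: 'f2, f1 :: 'f1, kb :: 'kb, ka :: 'ka). (f2, f1))"
    and "KA' = (\<lambda>(ys :: bool list, xs :: bool list, f2 :: 'f2, f1 :: 'f1, kb :: 'kb, ka :: 'ka). kb)"
    and "KB' = (\<lambda>(ys :: bool list, xs :: bool list, f2 :: 'f2, f1 :: 'f1, kb :: 'kb, ka :: 'ka). ka)"
  have fin': "finite (set_pmf P')" by (simp add: P'_def fin)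
  have P': "P' = code_law n (map_pmf prod.swap pxy) PF2 PF1
      (\<lambda>ys f2 f1. PKB ys f1 f2) (\<lambda>xs f2 f1. PKA xs f1 f2)"
    unfolding P'_def P_def swap_def code_law_swap ..
  have xor: "map2 (\<noteq>) ys xs = map2 (\<noteq>) xs ys" for xs ys :: "bool list"
    by (subst zip_commute) (auto simp: case_prod_unfold)
  have swap: "Zn' (swap w) = Zn w" "F' (swap w) = prod.swap (F w)"
    "KA' (swap w) = KB w" "KB' (swap w) = KA w" for w
    unfolding swap_def Zn'_def Zn_def F'_def F_def KA'_def KA_def KB'_def KB_def
    by (cases w, simp only: prod.case xor prod.swap_def fst_conv snd_conv)+
  have "pmf_cond_entropy P' Zn' F' = ent P (\<lambda>w. (Zn w, prod.swap (F w))) - ent P (\<lambda>w. prod.swap (F w))"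
    unfolding pmf_cond_entropy_ent[OF fin'] unfolding P'_def ent_map swap ..
  also have "\<dots> = pmf_cond_entropy P Zn F"
    unfolding pmf_cond_entropy_ent[OF fin]
    by (intro arg_cong2[where f = "(-)"] ent_cong) (simp_all add: inj_swap[THEN inj_eq])
  finally have HZ: "pmf_cond_entropy P' Zn' F' = pmf_cond_entropy P Zn F" .
  have "pmf_cond_mutual_information P' KA' KB' F' = ent P (\<lambda>w. (KB w, prod.swap (F w)))
      + ent P (\<lambda>w. (KA w, prod.swap (F w))) - ent P (\<lambda>w. (KB w, KA w, prod.swap (F w)))
      - ent P (\<lambda>w. prod.swap (F w))"
    unfolding pmf_cond_mutual_information_ent[OF fin'] unfolding P'_def ent_map swap ..
  also have "\<dots> = ent P (\<lambda>w. (KB w, F w)) + ent P (\<lambda>w. (KA w, F w))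
      - ent P (\<lambda>w. (KA w, KB w, F w)) - ent P F"
    by (intro arg_cong2[where f = "(-)"] arg_cong2[where f = "(+)"] ent_cong) (auto simp: inj_swap[THEN inj_eq])
  finally have I: "pmf_cond_mutual_information P' KA' KB' F' = pmf_cond_mutual_information P KA KB F"
    unfolding pmf_cond_mutual_information_ent[OF fin] by simp
  have "real n * Delta2 pxy \<le> real n * Delta1 (map_pmf prod.swap pxy)"
    by (intro mult_left_mono Delta2_le_swap) simp
  moreover have "real n * Delta1 (map_pmf prod.swap pxy) + pmf_cond_mutual_information P' KA' KB' F'
      \<le> 2 * pmf_cond_entropy P' Zn' F'"
    unfolding P' Zn'_def F'_def KA'_def KB'_def by (rule one_sided_bound)
  ultimately have 2: "real n * Delta2 pxy + pmf_cond_mutual_information P KA KB F \<le> 2 * pmf_cond_entropy P Zn F"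
    unfolding HZ I by linarith
  have "real n * Delta_bar pxy + pmf_cond_mutual_information P KA KB F \<le> 2 * pmf_cond_entropy P Zn F"
    using 1 2 by (simp add: Delta_bar_def max_def)
  then have "(real n * Delta_bar pxy + pmf_cond_mutual_information P KA KB F) / (2 * real n)
      \<le> 2 * pmf_cond_entropy P Zn F / (2 * real n)"
    by (rule divide_right_mono) simp
  then show ?thesis
    using \<open>n \<ge> 1\<close> by (simp add: add_divide_distrib)
qed

end
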